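(* Let $d\ge2$, let $\bar x\in\mathbb{R}^d\setminus\{0\}$, let $a\sim\mathsf{N}(0,I_d)$, and define $f_P(x):=\mathbb{E}_a\left[|\langle a,x\rangle^2-\langle a,\bar x\rangle^2|\right]$. For $x\in\mathbb{R}^d$ set $X:=xx^T-\bar x\bar x^T$. Then $$f_P(x)=\frac4\pi\left[\mathrm{Tr}(X)\cdot\arctan\left(\sqrt{\left|\frac{\lambda_{\max}(X)}{\lambda_{\min}(X)}\right|}\right)+\sqrt{|\lambda_{\max}(X)\lambda_{\min}(X)|}\right]-\mathrm{Tr}(X).$$
   Context: $\lambda_{\max}(X)$ and $\lambda_{\min}(X)$ denote the largest and smallest eigenvalues of the symmetric matrix $X$. Convention for degenerate cases: if $\lambda_{\min}(X)=0<\lambda_{\max}(X)$ then the arctangent is read as $\arctan(+\infty)=\pi/2$; if $X=0$ the right-hand side is read as $0$. *)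

theory Defs
  imports "HOL-Probability.Probability"
begin

text \<open>The Lebesgue density of the standard Gaussian distribution on \<open>\<real>\<^sup>d\<close>, where \<open>d = CARD('n)\<close>.\<close>

definition std_gaussian_density :: "real ^ 'n \<Rightarrow> real" where
  "std_gaussian_density z =
     (2 * pi) powr (- (real CARD('n) / 2)) * exp (- (norm z)\<^sup>2 / 2)"

definition std_gaussian :: "'w measure \<Rightarrow> ('w \<Rightarrow> real ^ 'n) \<Rightarrow> bool" where
  "std_gaussian M a \<longleftrightarrow> distributed M lborel a (\<lambda>z. ennreal (std_gaussian_density z))"

definition f_P :: "'w measure \<Rightarrow> ('w \<Rightarrow> real ^ 'n) \<Rightarrow> real ^ 'n \<Rightarrow> real ^ 'n \<Rightarrow> real" where
  "f_P M a xbar x = (LINT w|M. \<bar>(a w \<bullet> x)\<^sup>2 - (a w \<bullet> xbar)\<^sup>2\<bar>)"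

definition outer_square :: "real ^ 'n \<Rightarrow> real ^ 'n ^ 'n" where
  "outer_square x = (columnvector x :: real ^ 1 ^ 'n) ** (rowvector x :: real ^ 'n ^ 1)"

definition eigenvalues :: "real ^ 'n ^ 'n \<Rightarrow> real set" where
  "eigenvalues A = {l. \<exists>v. v \<noteq> 0 \<and> A *v v = l *\<^sub>R v}"

text \<open>For symmetric matrices, all of whose eigenvalues are real, the set of eigenvalues is
  finite and nonempty, so \<open>Max\<close> and \<open>Min\<close> are meaningful; for other matrices they may not be.\<close>

definition lambda_max :: "real ^ 'n ^ 'n \<Rightarrow> real" where
  "lambda_max A = Max (eigenvalues A)"

definition lambda_min :: "real ^ 'n ^ 'n \<Rightarrow> real" where
  "lambda_min A = Min (eigenvalues A)"

text \<open>The value of \<open>arctan (sqrt \<bar>\<lambda>\<^sub>m\<^sub>a\<^sub>x / \<lambda>\<^sub>m\<^sub>i\<^sub>n\<bar>)\<close>, read as \<open>arctan (+\<infinity>) = \<pi>/2\<close> if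
  \<open>\<lambda>\<^sub>m\<^sub>i\<^sub>n = 0 < \<lambda>\<^sub>m\<^sub>a\<^sub>x\<close>; without the case distinction, \<open>y / 0 = 0\<close> would give \<open>0\<close> there.\<close>

definition arctan_ratio :: "real ^ 'n ^ 'n \<Rightarrow> real" where
  "arctan_ratio X =
     (if lambda_min X = 0 \<and> 0 < lambda_max X then pi / 2
      else arctan (sqrt \<bar>lambda_max X / lambda_min X\<bar>))"

end

theory Submission
  imports Defs "HOL-Real_Asymp.Real_Asymp"
begin

text \<open>
  If \<open>x \<noteq> \<plusminus>xbar\<close>, a hyperbolic rotation of the pair \<open>(x, xbar)\<close> preserves \<open>X\<close> and makes the pair
  orthogonal, so \<open>X = u u\<^sup>T - v v\<^sup>T\<close> with \<open>u \<bottom> v\<close>; then \<open>\<lambda>\<^sub>m\<^sub>a\<^sub>x = p\<close> and \<open>\<lambda>\<^sub>m\<^sub>i\<^sub>n = - q\<close>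
  for \<open>p = \<bar>u\<bar>\<^sup>2\<close>, \<open>q = \<bar>v\<bar>\<^sup>2\<close>. By rotation invariance of the Gaussian the expectation is that of
  \<open>\<bar>p s\<^sup>2 - q t\<^sup>2\<bar>\<close> for independent standard normal \<open>s\<close>, \<open>t\<close>. Substituting \<open>s = r t\<close> and
  integrating out \<open>t\<close> leaves \<open>(2/\<pi>) \<integral> \<bar>p r\<^sup>2 - q\<bar> / (1 + r\<^sup>2)\<^sup>2 dr\<close>, which has an elementary
  antiderivative.
\<close>

subsection \<open>Rotations and Lebesgue measure\<close>

text \<open>By Vitali's theorem an open set is, up to a null set, a disjoint union of balls, and an
  isometry preserves their measure.\<close>

lemma emeasure_le_emeasure_orthogonal_image:
  fixes T :: "'a::euclidean_space \<Rightarrow> 'a"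
  assumes T: "orthogonal_transformation T" and U: "open U"
  shows "emeasure lborel U \<le> emeasure lborel (T ` U)"
proof -
  define K where "K = {(c, r). 0 < r \<and> cball c r \<subseteq> U}"
  have cover: "\<exists>i. i \<in> K \<and> x \<in> cball (fst i) (snd i) \<and> snd i < d" if "x \<in> U" "0 < d" for x d
  proof -
    obtain e where e: "0 < e" "cball x e \<subseteq> U"
      using U \<open>x \<in> U\<close> open_contains_cball by blast
    \<comment> \<open>The radius \<open>min e (d / 2)\<close> stays inside \<open>U\<close> because
      of \<open>e\<close> and strictly below \<open>d\<close> because of
      \<open>d / 2\<close>.\<close>
    then show ?thesis
      using \<open>0 < d\<close> by (intro exI[of _ "(x, min e (d / 2))"]) (auto simp: K_def)
  qed
  obtain C where C: "countable C" "C \<subseteq> K"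
      and disj: "pairwise (\<lambda>i j. disjnt (cball (fst i) (snd i)) (cball (fst j) (snd j))) C"
      and neg: "negligible (U - (\<Union>i\<in>C. cball (fst i) (snd i)))"
  proof (rule Vitali_covering_theorem_cballs[of K snd U fst])
    show "0 < snd i" if "i \<in> K" for i
      using that by (auto simp: K_def)
  qed (use cover in blast)+
  have sub: "cball (fst i) (snd i) \<subseteq> U" if "i \<in> C" for i
    using subsetD[OF C(2) that] by (simp add: K_def case_prod_unfold)
  define V where "V = (\<Union>i\<in>C. cball (fst i) (snd i))"
  have V_borel: "V \<in> sets borel"
    unfolding V_def using C(1) by (intro sets.countable_UN') auto
  have image_cball: "T ` cball c r = cball (T c) r" for c r
    using T by (rule image_orthogonal_transformation_cball)
  have inj: "inj T"
    using T by (rule orthogonal_transformation_inj)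
  have disj_fam: "disjoint_family_on (\<lambda>i. cball (fst i) (snd i)) C"
    using disj by (auto simp: disjoint_family_on_def pairwise_def disjnt_def)
  have disj_T: "disjoint_family_on (\<lambda>i. T ` cball (fst i) (snd i)) C"
    using disj_fam inj unfolding disjoint_family_on_def
    by (metis image_Int image_empty)
  \<comment> \<open>Vitali's theorem yields a null set for the completed measure only. Since
    \<open>V\<close> is a countable union of closed balls, \<open>U - V\<close> is Borel and so is
    null for \<open>lborel\<close> too.\<close>
  have "U - V \<in> null_sets lebesgue"
    using neg by (simp add: negligible_iff_null_sets V_def)
  then have "U - V \<in> null_sets lborel"
    using U V_borel by (subst (asm) null_sets_completion_iff) auto
  then have "emeasure lborel U = emeasure lborel (U - (U - V))"
    using U by (subst emeasure_Diff_null_set) auto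
  also have "U - (U - V) = V"
    using sub by (force simp: V_def)
  also have "emeasure lborel V = (\<integral>\<^sup>+i. emeasure lborel (cball (fst i) (snd i)) \<partial>count_space C)"
    unfolding V_def using C(1) disj_fam by (intro emeasure_UN_countable) auto
  also have "\<dots> = (\<integral>\<^sup>+i. emeasure lborel (T ` cball (fst i) (snd i)) \<partial>count_space C)"
    using C(2) by (intro nn_integral_cong) (auto simp: image_cball emeasure_cball K_def)
  also have "\<dots> = emeasure lborel (\<Union>i\<in>C. T ` cball (fst i) (snd i))"
    using C(1) disj_T by (intro emeasure_UN_countable[symmetric]) (auto simp: image_cball)
  \<comment> \<open>Dropping the image of \<open>U - V\<close> can only lower the measure, so
    whether this image is null need not be settled. The reverse inequality will come from the
    inverse of \<open>T\<close>.\<close>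
  also have "\<dots> \<le> emeasure lborel (T ` U)"
  proof (rule emeasure_mono)
    show "(\<Union>i\<in>C. T ` cball (fst i) (snd i)) \<subseteq> T ` U"
      using sub by blast
    have "open (T ` U)"
      using open_surjective_linear_image[OF U] T orthogonal_transformation_linear
        orthogonal_transformation_surj by blast
    then show "T ` U \<in> sets lborel" by simp
  qed
  finally show ?thesis .
qed

text \<open>The preceding inequality, used for \<open>T\<close> on the preimage of a box and for
  \<open>inv T\<close> on the box, gives equality on boxes, and these determine Lebesgue
  measure.\<close>

lemma distr_lborel_orthogonal_transformation:
  fixes T :: "'a::euclidean_space \<Rightarrow> 'a"
  assumes T: "orthogonal_transformation T"
  shows "distr lborel borel T = lborel"
proof (rule lborel_eqI[symmetric])
  have bij: "bij T" and T': "orthogonal_transformation (inv T)" and lin: "linear T"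
    using T by (auto simp: orthogonal_transformation_bij orthogonal_transformation_inv
        orthogonal_transformation_linear)
  have [measurable]: "T \<in> borel_measurable borel"
    using lin by (intro borel_measurable_continuous_onI linear_continuous_on linear_conv_bounded_linear[THEN iffD1])
  fix l u :: 'a
  assume le: "\<And>b. b \<in> Basis \<Longrightarrow> l \<bullet> b \<le> u \<bullet> b"
  have vimage: "T -` box l u = inv T ` box l u"
    using bij by (simp add: bij_vimage_eq_inv_image)
  have "open (T -` box l u)"
    using lin by (intro open_vimage linear_continuous_on linear_conv_bounded_linear[THEN iffD1]) auto
  then have "emeasure lborel (T -` box l u) \<le> emeasure lborel (T ` (T -` box l u))"
    using T emeasure_le_emeasure_orthogonal_image by blast
  also have "T ` (T -` box l u) = box l u"
    using bij by (simp add: bij_is_surj surj_image_vimage_eq)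
  finally have "emeasure lborel (T -` box l u) = emeasure lborel (box l u)"
    using emeasure_le_emeasure_orthogonal_image[OF T', of "box l u"]
    by (simp add: vimage open_box order_antisym)
  then show "emeasure (distr lborel borel T) (box l u) = (\<Prod>b\<in>Basis. (u - l) \<bullet> b)"
    using le by (simp add: emeasure_distr emeasure_lborel_box inner_diff_left)
qed simp

text \<open>The witness is the Householder reflection along \<open>u - w\<close>; equal norms make
  its mirror hyperplane the bisector of \<open>u\<close> and \<open>w\<close>. The fixed vectors are
  recorded so that a second reflection can follow without undoing the first.\<close>

lemma orthogonal_transformation_reflection:
  fixes u w :: "'a::euclidean_space"
  assumes "norm u = norm w"
  obtains T where "orthogonal_transformation T" "T u = w"
    "\<And>z. z \<bullet> u = 0 \<Longrightarrow> z \<bullet> w = 0 \<Longrightarrow> T z = z"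
proof
  define e where "e = u - w"
  \<comment> \<open>If \<open>e = 0\<close> then \<open>T\<close> is the identity, as wanted, because \<open>y / 0 = 0\<close>.\<close>
  define T where "T z = z - (2 * (z \<bullet> e) / (e \<bullet> e)) *\<^sub>R e" for z
  have eq: "u \<bullet> u = w \<bullet> w"
    using assms by (simp add: norm_eq)
  have lin: "linear T"
    by (rule linearI) (simp_all add: T_def algebra_simps add_divide_distrib)
  have "T v \<bullet> T z = v \<bullet> z" for v z
  proof (cases "e = 0")
    case False
    then have "e \<bullet> e \<noteq> 0" by simp
    then show ?thesis
      by (simp add: T_def inner_diff_left inner_diff_right inner_commute field_simps)
  qed (simp add: T_def)
  with lin show "orthogonal_transformation T"
    by (simp add: orthogonal_transformation_def)
  have ee: "e \<bullet> e = 2 * (u \<bullet> e)"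
    using eq by (simp add: e_def inner_diff_left inner_diff_right inner_commute)
  show "T u = w"
  proof (cases "e = 0")
    case False
    then have "e \<bullet> e \<noteq> 0" by simp
    then have "2 * (u \<bullet> e) / (e \<bullet> e) = 1"
      using ee by (metis divide_self)
    then have "T u = u - e"
      by (simp only: T_def scaleR_one)
    then show ?thesis
      by (simp add: e_def)
  qed (simp add: T_def e_def)
  show "T z = z" if "z \<bullet> u = 0" "z \<bullet> w = 0" for z
    using that by (simp add: T_def e_def inner_diff_right)
qed

text \<open>Two reflections suffice: \<open>R\<close> sends \<open>u\<close> to its axis, then
  \<open>S\<close> sends \<open>R v\<close> to the other axis. \<open>S\<close> fixes
  \<open>R u\<close>, which is orthogonal both to \<open>R v\<close> and to the target of
  \<open>R v\<close>.\<close>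

lemma orthogonal_transformation_to_axes:
  fixes u v :: "real ^ 'n" and i j :: 'n
  assumes "u \<bullet> v = 0" "i \<noteq> j"
  obtains T where "orthogonal_transformation T" "T u = axis i (norm u)" "T v = axis j (norm v)"
proof -
  have norms: "norm (axis k c :: real ^ 'n) = \<bar>c\<bar>" for k c
    by (simp add: norm_eq_sqrt_inner inner_axis_axis)
  have "norm u = norm (axis i (norm u) :: real ^ 'n)"
    by (simp add: norms)
  then obtain R where R: "orthogonal_transformation R" "R u = axis i (norm u)"
    using orthogonal_transformation_reflection by blast
  have R_inner: "R u \<bullet> R v = 0"
    using R(1) assms(1) by (simp add: orthogonal_transformation_def)
  have "norm (R v) = norm (axis j (norm v) :: real ^ 'n)"
    using R(1) by (simp add: norms orthogonal_transformation_norm)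
  then obtain S where S: "orthogonal_transformation S" "S (R v) = axis j (norm v)"
      "\<And>z. z \<bullet> R v = 0 \<Longrightarrow> z \<bullet> axis j (norm v) = 0 \<Longrightarrow> S z = z"
    using orthogonal_transformation_reflection by blast
  have "R u \<bullet> axis j (norm v) = 0"
    using \<open>i \<noteq> j\<close> by (simp add: R(2) inner_axis_axis)
  then have "S (R u) = axis i (norm u)"
    using S(3) R_inner R(2) by metis
  then show ?thesis
    using that[of "S \<circ> R"] R(1) S(1,2) by (simp add: orthogonal_transformation_compose)
qed

subsection \<open>Differences of rank-one matrices\<close>

lemma outer_square_nth: "outer_square x $ i $ j = x $ i * x $ j"
  by (simp add: outer_square_def columnvector_def rowvector_def matrix_matrix_mult_def)

lemma outer_square_mult: "outer_square x *v w = (x \<bullet> w) *\<^sub>R x"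
  by (simp add: vec_eq_iff matrix_vector_mult_def outer_square_nth inner_vec_def
      sum_distrib_right sum_distrib_left mult_ac)

lemma trace_outer_square: "trace (outer_square x) = x \<bullet> x"
  by (simp add: trace_def outer_square_nth inner_vec_def)

lemma inner_outer_square: "w \<bullet> (outer_square x *v w) = (w \<bullet> x)\<^sup>2"
  by (simp add: outer_square_mult inner_commute power2_eq_square)

lemma orthogonal_outer_square_diff:
  fixes x y :: "real ^ 'n"
  assumes "outer_square x \<noteq> outer_square y"
  obtains u v :: "real ^ 'n"
    where "u \<bullet> v = 0" "outer_square x - outer_square y = outer_square u - outer_square v"
proof -
  have "outer_square (- y) = outer_square y"
    by (simp add: vec_eq_iff outer_square_nth)
  then have "x - y \<noteq> 0" "x + y \<noteq> 0"
    using assms by (auto simp: add_eq_0_iff2)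
  \<comment> \<open>In the light-cone coordinates \<open>x + y\<close>, \<open>x - y\<close> the hyperbolic rotation is the scaling by
    \<open>c\<close>, \<open>1 / c\<close>; orthogonality of \<open>u\<close> and \<open>v\<close> means \<open>norm P = norm M\<close>, which determines \<open>c\<close>.\<close>
  define c where "c = sqrt (norm (x - y) / norm (x + y))"
  have c: "0 < c" "c\<^sup>2 = norm (x - y) / norm (x + y)"
    using \<open>x - y \<noteq> 0\<close> \<open>x + y \<noteq> 0\<close> by (simp_all add: c_def)
  define P M where "P = c *\<^sub>R (x + y)" and "M = (1 / c) *\<^sub>R (x - y)"
  have "(norm P)\<^sup>2 = c\<^sup>2 * (norm (x + y))\<^sup>2" "(norm M)\<^sup>2 = (norm (x - y))\<^sup>2 / c\<^sup>2"
    by (simp_all add: P_def M_def power_mult_distrib power_divide)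
  then have "(norm P)\<^sup>2 = (norm M)\<^sup>2"
    using \<open>x - y \<noteq> 0\<close> \<open>x + y \<noteq> 0\<close> unfolding c(2) by (simp add: power2_eq_square)
  then have PM: "P \<bullet> P = M \<bullet> M"
    by (simp add: power2_norm_eq_inner)
  define u v where "u = (1 / 2) *\<^sub>R (P + M)" and "v = (1 / 2) *\<^sub>R (P - M)"
  have 1: "u \<bullet> v = 0"
    using PM by (simp add: u_def v_def inner_add_left inner_add_right inner_diff_left inner_diff_right
        inner_commute[of M P])
  \<comment> \<open>Each entry is bilinear in \<open>P\<close> and \<open>M\<close>, so the factors
    \<open>c\<close> and \<open>1 / c\<close> cancel and the original matrix reappears.\<close>
  have "u $ i * u $ j - v $ i * v $ j = (P $ i * M $ j + M $ i * P $ j) / 2" for i j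
    by (simp add: u_def v_def field_simps)
  also have "(P $ i * M $ j + M $ i * P $ j) / 2 = x $ i * x $ j - y $ i * y $ j" for i j
    using c(1) by (simp add: P_def M_def field_simps)
  finally have 2: "outer_square x - outer_square y = outer_square u - outer_square v"
    by (simp add: vec_eq_iff outer_square_nth)
  from 1 2 that show ?thesis by blast
qed

context
  fixes u v :: "real ^ 'n"
  assumes card: "CARD('n) \<ge> 2" and orth: "u \<bullet> v = 0"
begin

text \<open>Pairing the eigenvector equation with \<open>u\<close> and with \<open>v\<close> leaves
  only three candidates. The value 0 is not claimed to be attained: it is no eigenvalue if the
  dimension is 2 and \<open>u\<close>, \<open>v\<close> are nonzero. Lying between the other two
  values, it never affects the extremes.\<close>

lemma eigenvalues_outer_square_diff:
  defines "E \<equiv> eigenvalues (outer_square u - outer_square v)"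
  shows "E \<subseteq> {u \<bullet> u, 0, - (v \<bullet> v)}" "u \<bullet> u \<in> E" "- (v \<bullet> v) \<in> E"
proof -
  have mult: "(outer_square u - outer_square v) *v w = (u \<bullet> w) *\<^sub>R u - (v \<bullet> w) *\<^sub>R v" for w
    by (simp add: matrix_vector_mult_diff_rdistrib outer_square_mult)
  have orth': "v \<bullet> u = 0"
    using orth by (simp add: inner_commute)
  show "E \<subseteq> {u \<bullet> u, 0, - (v \<bullet> v)}"
  proof
    fix l assume "l \<in> E"
    then obtain w where "w \<noteq> 0" and w: "(u \<bullet> w) *\<^sub>R u - (v \<bullet> w) *\<^sub>R v = l *\<^sub>R w"
      by (auto simp: E_def eigenvalues_def mult)
    have "u \<bullet> ((u \<bullet> w) *\<^sub>R u - (v \<bullet> w) *\<^sub>R v) = l * (u \<bullet> w)" "v \<bullet> ((u \<bullet> w) *\<^sub>R u - (v \<bullet> w) *\<^sub>R v) = l * (v \<bullet> w)"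
      by (simp_all add: w)
    then have "(u \<bullet> w) * (u \<bullet> u - l) = 0" "(v \<bullet> w) * (v \<bullet> v + l) = 0"
      by (simp_all add: inner_diff_right orth orth' algebra_simps)
    moreover have "l = 0" if "u \<bullet> w = 0" "v \<bullet> w = 0"
      using w that \<open>w \<noteq> 0\<close> by simp
    ultimately show "l \<in> {u \<bullet> u, 0, - (v \<bullet> v)}"
      by auto
  qed
  \<comment> \<open>If \<open>u = 0\<close> or \<open>v = 0\<close>, that vector is no eigenvector,
    yet 0 must still be an eigenvalue. A nonzero vector orthogonal to the other one is then in the
    kernel; it exists because the dimension is at least 2.\<close>
  have "2 \<le> DIM(real ^ 'n)"
    using card by simp
  then obtain u' v' where u': "u' \<noteq> 0" "v \<bullet> u' = 0" and v': "v' \<noteq> 0" "u \<bullet> v' = 0"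
    by (metis orthogonal_to_vector_exists orthogonal_def)
  have E_I: "l \<in> E" if "w \<noteq> 0" "(u \<bullet> w) *\<^sub>R u - (v \<bullet> w) *\<^sub>R v = l *\<^sub>R w" for l w
    using that by (auto simp: E_def eigenvalues_def mult)
  show "u \<bullet> u \<in> E"
    using E_I[of u "u \<bullet> u"] E_I[of u' 0] u' by (cases "u = 0") (simp_all add: orth')
  show "- (v \<bullet> v) \<in> E"
    using E_I[of v "- (v \<bullet> v)"] E_I[of v' 0] v' by (cases "v = 0") (simp_all add: orth)
qed

lemma lambda_max_outer_square_diff:
  "lambda_max (outer_square u - outer_square v) = u \<bullet> u"
  unfolding lambda_max_def
proof (rule Max_eqI)
  show "y \<le> u \<bullet> u" if "y \<in> eigenvalues (outer_square u - outer_square v)" for y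
    using subsetD[OF eigenvalues_outer_square_diff(1) that] inner_ge_zero[of u] inner_ge_zero[of v]
    by (auto simp del: inner_ge_zero)
qed (use eigenvalues_outer_square_diff in \<open>auto intro: finite_subset\<close>)

lemma lambda_min_outer_square_diff:
  "lambda_min (outer_square u - outer_square v) = - (v \<bullet> v)"
  unfolding lambda_min_def
proof (rule Min_eqI)
  show "- (v \<bullet> v) \<le> y" if "y \<in> eigenvalues (outer_square u - outer_square v)" for y
    using subsetD[OF eigenvalues_outer_square_diff(1) that] inner_ge_zero[of u] inner_ge_zero[of v]
    by (auto simp del: inner_ge_zero)
qed (use eigenvalues_outer_square_diff in \<open>auto intro: finite_subset\<close>)

end

subsection \<open>Gaussian integrals\<close>

text \<open>Rescaling by \<open>1 / sqrt c\<close> reduces the integral to the third absolute moment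
  of the standard normal law, which is \<open>2 * sqrt (2 / pi)\<close>.\<close>

lemma nn_integral_cubic_gaussian:
  fixes c :: real
  assumes "0 < c"
  shows "(\<integral>\<^sup>+t. ennreal (\<bar>t\<bar> ^ 3 * exp (- (c * t\<^sup>2) / 2)) \<partial>lborel) = ennreal (4 / c\<^sup>2)"
proof -
  have moment: "has_bochner_integral lborel (\<lambda>t. std_normal_density t * \<bar>t\<bar> ^ 3) (2 * sqrt (2 / pi))"
    using std_normal_moment_abs_odd[of 1] by (simp add: mult.commute)
  have eq: "\<bar>0 + 1 / sqrt c * t\<bar> ^ 3 * exp (- (c * (0 + 1 / sqrt c * t)\<^sup>2) / 2) =
      sqrt (2 * pi) / sqrt c ^ 3 * (std_normal_density t * \<bar>t\<bar> ^ 3)" for t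
    using assms by (simp add: std_normal_density_def power_mult_distrib power_divide abs_mult
        del: real_sqrt_power)
  have "(\<integral>\<^sup>+t. ennreal (\<bar>t\<bar> ^ 3 * exp (- (c * t\<^sup>2) / 2)) \<partial>lborel) =
      ennreal \<bar>1 / sqrt c\<bar> *
        (\<integral>\<^sup>+t. ennreal (sqrt (2 * pi) / sqrt c ^ 3 * (std_normal_density t * \<bar>t\<bar> ^ 3)) \<partial>lborel)"
    using assms by (subst nn_integral_real_affine[where c = "1 / sqrt c" and t = 0]) (simp_all only: eq, simp_all)
  also have "(\<integral>\<^sup>+t. ennreal (sqrt (2 * pi) / sqrt c ^ 3 * (std_normal_density t * \<bar>t\<bar> ^ 3)) \<partial>lborel) =
      ennreal (sqrt (2 * pi) / sqrt c ^ 3 * (2 * sqrt (2 / pi)))"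
    using has_bochner_integral_mult_right[OF moment, of "sqrt (2 * pi) / sqrt c ^ 3"] assms
    by (subst nn_integral_eq_integral) (auto simp: has_bochner_integral_iff)
  also have "ennreal \<bar>1 / sqrt c\<bar> * \<dots> = ennreal (4 / c\<^sup>2)"
  proof -
    have "sqrt (2 * pi) * sqrt (2 / pi) = 2"
      by (simp add: real_sqrt_mult[symmetric])
    moreover have "sqrt c * sqrt c ^ 3 = c\<^sup>2"
      using assms by (simp add: power3_eq_cube power2_eq_square)
    ultimately show ?thesis
      using assms by (simp add: ennreal_mult'[symmetric] field_simps)
  qed
  finally show ?thesis .
qed

text \<open>With \<open>s = t * r\<close> the form factors as
  \<open>t\<^sup>2 * (p * r\<^sup>2 - q)\<close>. Together with the Jacobian this gives a cubic
  Gaussian moment in \<open>t\<close> with parameter \<open>1 + r\<^sup>2\<close>, which Tonelli's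
  theorem allows to be integrated first. The constant \<open>2 / pi\<close> is 4 from that moment
  times \<open>1 / (2 * pi)\<close> from the two densities.\<close>

lemma nn_integral_std_normal_quadratic_form:
  fixes p q :: real
  shows "(\<integral>\<^sup>+t. \<integral>\<^sup>+s. ennreal (std_normal_density s * std_normal_density t * \<bar>p * s\<^sup>2 - q * t\<^sup>2\<bar>) \<partial>lborel \<partial>lborel) =
    (\<integral>\<^sup>+r. ennreal (2 / pi * (\<bar>p * r\<^sup>2 - q\<bar> / (1 + r\<^sup>2)\<^sup>2)) \<partial>lborel)"
proof -
  define w where "w r = \<bar>p * r\<^sup>2 - q\<bar> / (2 * pi)" for r
  have w: "0 \<le> w r" for r by (simp add: w_def)
  have [measurable]: "w \<in> borel_measurable borel" unfolding w_def by measurable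
  have eq: "\<bar>t\<bar> * (std_normal_density (0 + t * r) * std_normal_density t * \<bar>p * (0 + t * r)\<^sup>2 - q * t\<^sup>2\<bar>) =
      w r * (\<bar>t\<bar> ^ 3 * exp (- ((1 + r\<^sup>2) * t\<^sup>2) / 2))" for t r
  proof -
    have "p * (t * r)\<^sup>2 - q * t\<^sup>2 = t\<^sup>2 * (p * r\<^sup>2 - q)"
      by (simp add: power_mult_distrib algebra_simps)
    then have "\<bar>p * (t * r)\<^sup>2 - q * t\<^sup>2\<bar> = \<bar>t\<bar>\<^sup>2 * \<bar>p * r\<^sup>2 - q\<bar>"
      by (simp add: abs_mult)
    moreover have "std_normal_density (t * r) * std_normal_density t =
        exp (- ((1 + r\<^sup>2) * t\<^sup>2) / 2) / (2 * pi)"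
      by (simp add: std_normal_density_def exp_add[symmetric] power_mult_distrib field_simps)
    ultimately show ?thesis
      by (simp add: w_def power3_eq_cube power2_eq_square)
  qed
  \<comment> \<open>The substitution degenerates at \<open>t = 0\<close>, a null set that the outer
    integral ignores.\<close>
  have inner: "(\<integral>\<^sup>+s. ennreal (std_normal_density s * std_normal_density t * \<bar>p * s\<^sup>2 - q * t\<^sup>2\<bar>) \<partial>lborel) =
      (\<integral>\<^sup>+r. ennreal (w r * (\<bar>t\<bar> ^ 3 * exp (- ((1 + r\<^sup>2) * t\<^sup>2) / 2))) \<partial>lborel)" if "t \<noteq> 0" for t
  proof -
    have "(\<integral>\<^sup>+s. ennreal (std_normal_density s * std_normal_density t * \<bar>p * s\<^sup>2 - q * t\<^sup>2\<bar>) \<partial>lborel) =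
        ennreal \<bar>t\<bar> * (\<integral>\<^sup>+r. ennreal (std_normal_density (0 + t * r) * std_normal_density t *
          \<bar>p * (0 + t * r)\<^sup>2 - q * t\<^sup>2\<bar>) \<partial>lborel)"
      using that by (intro nn_integral_real_affine) auto
    also have "\<dots> = (\<integral>\<^sup>+r. ennreal \<bar>t\<bar> * ennreal (std_normal_density (0 + t * r) * std_normal_density t *
          \<bar>p * (0 + t * r)\<^sup>2 - q * t\<^sup>2\<bar>) \<partial>lborel)"
      by (intro nn_integral_cmult[symmetric]) measurable
    finally show ?thesis
      by (simp only: ennreal_mult'[symmetric] abs_ge_zero eq)
  qed
  have "(\<integral>\<^sup>+t. \<integral>\<^sup>+s. ennreal (std_normal_density s * std_normal_density t * \<bar>p * s\<^sup>2 - q * t\<^sup>2\<bar>) \<partial>lborel \<partial>lborel) =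
      (\<integral>\<^sup>+t. \<integral>\<^sup>+r. ennreal (w r * (\<bar>t\<bar> ^ 3 * exp (- ((1 + r\<^sup>2) * t\<^sup>2) / 2))) \<partial>lborel \<partial>lborel)"
    using AE_lborel_singleton[of "0::real"] by (intro nn_integral_cong_AE) (auto simp: inner)
  also have "\<dots> = (\<integral>\<^sup>+r. \<integral>\<^sup>+t. ennreal (w r * (\<bar>t\<bar> ^ 3 * exp (- ((1 + r\<^sup>2) * t\<^sup>2) / 2))) \<partial>lborel \<partial>lborel)"
    by (rule lborel_pair.Fubini') measurable
  also have "\<dots> = (\<integral>\<^sup>+r. ennreal (2 / pi * (\<bar>p * r\<^sup>2 - q\<bar> / (1 + r\<^sup>2)\<^sup>2)) \<partial>lborel)"
  proof (rule nn_integral_cong)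
    fix r :: real
    have pos: "0 < 1 + r\<^sup>2" by (simp add: add_pos_nonneg)
    have "(\<integral>\<^sup>+t. ennreal (w r * (\<bar>t\<bar> ^ 3 * exp (- ((1 + r\<^sup>2) * t\<^sup>2) / 2))) \<partial>lborel) =
        ennreal (w r) * ennreal (4 / (1 + r\<^sup>2)\<^sup>2)"
      using w by (simp add: ennreal_mult' nn_integral_cmult nn_integral_cubic_gaussian[OF pos, symmetric])
    also have "\<dots> = ennreal (2 / pi * (\<bar>p * r\<^sup>2 - q\<bar> / (1 + r\<^sup>2)\<^sup>2))"
      using w by (simp add: ennreal_mult'[symmetric] w_def field_simps)
    finally show "(\<integral>\<^sup>+t. ennreal (w r * (\<bar>t\<bar> ^ 3 * exp (- ((1 + r\<^sup>2) * t\<^sup>2) / 2))) \<partial>lborel) =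
        ennreal (2 / pi * (\<bar>p * r\<^sup>2 - q\<bar> / (1 + r\<^sup>2)\<^sup>2))" .
  qed
  finally show ?thesis .
qed


text \<open>On the half-line the integrand without absolute value changes sign at most once, at
  \<open>sqrt (q / p)\<close>, so its antiderivative \<open>F\<close> gives the integral as the
  limit of \<open>F\<close> at infinity minus twice its value there. The case split in
  \<open>\<theta>\<close> mirrors the one in \<open>arctan_ratio\<close>.\<close>

lemma nn_integral_abs_quadratic_kernel:
  fixes p q :: real
  assumes p: "0 \<le> p" and q: "0 \<le> q"
  defines "\<theta> \<equiv> (if q = 0 \<and> 0 < p then pi / 2 else arctan (sqrt (p / q)))"
  defines "I \<equiv> (p - q) * \<theta> + sqrt (p * q) - (p - q) * pi / 4"
  shows "0 \<le> I"
    "(\<integral>\<^sup>+r. ennreal (\<bar>p * r\<^sup>2 - q\<bar> / (1 + r\<^sup>2)\<^sup>2) * indicator {0..} r \<partial>lborel) = ennreal I"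
proof -
  define g where "g r = (p * r\<^sup>2 - q) / (1 + r\<^sup>2)\<^sup>2" for r
  \<comment> \<open>Write the numerator as \<open>p * (1 + r\<^sup>2) - (p + q)\<close> and use that
    \<open>1 / (1 + r\<^sup>2)\<^sup>2\<close> has the antiderivative
    \<open>(arctan r + r / (1 + r\<^sup>2)) / 2\<close>.\<close>
  define F where "F r = ((p - q) * arctan r - (p + q) * (r / (1 + r\<^sup>2))) / 2" for r
  have pos: "0 < 1 + r\<^sup>2" for r :: real
    by (simp add: add_pos_nonneg)
  have F_deriv: "(F has_real_derivative g r) (at r)" for r
  proof -
    have nz: "1 + r\<^sup>2 \<noteq> 0"
      using pos[of r] by simp
    have "(F has_real_derivative
        ((p - q) * inverse (1 + r\<^sup>2) - (p + q) * ((1 * (1 + r\<^sup>2) - r * (2 * r)) / ((1 + r\<^sup>2) * (1 + r\<^sup>2)))) / 2) (at r)"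
      unfolding F_def using nz
      by (auto intro!: derivative_eq_intros) (simp add: power2_eq_square algebra_simps)
    moreover have "((p - q) * inverse (1 + r\<^sup>2) - (p + q) * ((1 * (1 + r\<^sup>2) - r * (2 * r)) / ((1 + r\<^sup>2) * (1 + r\<^sup>2)))) / 2 = g r"
      using nz by (simp add: g_def divide_simps power2_eq_square) algebra
    ultimately show ?thesis by simp
  qed
  have F_lim: "(F \<longlongrightarrow> (p - q) * pi / 4) at_top"
  proof -
    have "((\<lambda>r::real. r / (1 + r\<^sup>2)) \<longlongrightarrow> 0) at_top"
      by real_asymp
    then have "(F \<longlongrightarrow> ((p - q) * (pi / 2) - (p + q) * 0) / 2) at_top"
      unfolding F_def by (intro tendsto_intros tendsto_arctan_at_top) auto
    then show ?thesis by simp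
  qed
  have [measurable]: "g \<in> borel_measurable borel"
    unfolding g_def by measurable
  have g: "\<bar>p * r\<^sup>2 - q\<bar> / (1 + r\<^sup>2)\<^sup>2 = \<bar>g r\<bar>" for r
    by (simp add: g_def)
  have "0 \<le> I \<and> (\<integral>\<^sup>+r. ennreal \<bar>g r\<bar> * indicator {0..} r \<partial>lborel) = ennreal I"
  \<comment> \<open>For \<open>p = 0\<close> the kernel is nowhere positive, whereas
    \<open>q / 0 = 0\<close> would place the sign change at 0 and predict the opposite sign.\<close>
  proof (cases "p = 0")
    case True
    then have "\<bar>g r\<bar> = - g r" for r
      using q by (simp add: g_def)
    moreover have "(\<integral>\<^sup>+r. ennreal (- g r) * indicator {0..} r \<partial>lborel) = ennreal (- ((p - q) * pi / 4) - - F 0)"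
      using True q by (intro nn_integral_FTC_atLeast DERIV_minus F_deriv tendsto_minus F_lim)
        (auto simp: g_def)
    ultimately show ?thesis
      using True q by (simp add: I_def \<theta>_def F_def)
  next
    case False
    then have "0 < p" using p by simp
    define r0 where "r0 = sqrt (q / p)"
    have r0: "0 \<le> r0" "r0\<^sup>2 = q / p"
      using p q by (simp_all add: r0_def)
    have g_nonneg: "0 \<le> g r" if "r0 \<le> r" for r
    proof -
      have "q / p \<le> r\<^sup>2"
        using power_mono[OF that r0(1), of 2] by (simp add: r0)
      then show ?thesis
        using \<open>0 < p\<close> by (simp add: g_def field_simps)
    qed
    have g_nonpos: "g r \<le> 0" if "0 \<le> r" "r \<le> r0" for r
    proof -
      have "r\<^sup>2 \<le> q / p"
        using power_mono[OF that(2,1), of 2] by (simp add: r0)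
      then show ?thesis
        unfolding g_def using \<open>0 < p\<close> by (intro divide_nonpos_nonneg) (simp_all add: field_simps)
    qed
    have upper: "(\<integral>\<^sup>+r. ennreal (g r) * indicator {r0..} r \<partial>lborel) = ennreal ((p - q) * pi / 4 - F r0)"
      using g_nonneg by (intro nn_integral_FTC_atLeast F_deriv F_lim) auto
    have lower: "(\<integral>\<^sup>+r. ennreal (- g r) * indicator {0..r0} r \<partial>lborel) = ennreal (- F r0 - - F 0)"
    proof (rule nn_integral_FTC_Icc)
      show "((\<lambda>r. - F r) has_real_derivative - g r) (at r)" if "r \<in> {0..r0}" for r
        by (rule DERIV_minus[OF F_deriv])
      show "0 \<le> - g r" if "r \<in> {0..r0}" for r
        using g_nonpos that by simp
    qed (use r0(1) in simp_all)
    \<comment> \<open>Because \<open>ennreal\<close> sends negative numbers to 0, the two pieces can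
      be added as reals only once both are known to be nonnegative. The monotonicity of
      \<open>F\<close> on either side of \<open>r0\<close> shows this.\<close>
    have mono: "F r0 \<le> F r" if "r0 \<le> r" for r
      by (rule DERIV_nonneg_imp_nondecreasing[OF that]) (use g_nonneg F_deriv in blast)
    have "F r0 \<le> (p - q) * pi / 4"
      using F_lim mono by (intro tendsto_lowerbound[OF F_lim]) (auto simp: eventually_at_top_linorder)
    moreover have "F r0 \<le> F 0"
      by (rule DERIV_nonpos_imp_nonincreasing[OF r0(1)]) (use g_nonpos F_deriv in blast)
    moreover have "F 0 = 0" by (simp add: F_def)
    moreover have "\<bar>g r\<bar> = (if r0 \<le> r then g r else - g r)" if "0 \<le> r" for r
      using g_nonneg[of r] g_nonpos[of r] that by auto
    ultimately have nonneg: "0 \<le> (p - q) * pi / 4 - F r0" "0 \<le> - F r0"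
      and g_abs: "\<And>r. 0 \<le> r \<Longrightarrow> \<bar>g r\<bar> = (if r0 \<le> r then g r else - g r)"
      by auto
    have "(\<integral>\<^sup>+r. ennreal \<bar>g r\<bar> * indicator {0..} r \<partial>lborel) =
        (\<integral>\<^sup>+r. ennreal (g r) * indicator {r0..} r + ennreal (- g r) * indicator {0..r0} r \<partial>lborel)"
      \<comment> \<open>Both indicators contain \<open>r0\<close>, so the splitting holds only off
        this point.\<close>
      using AE_lborel_singleton[of r0] r0(1)
      by (intro nn_integral_cong_AE) (auto simp: g_abs indicator_def split: if_splits)
    also have "\<dots> = ennreal ((p - q) * pi / 4 - F r0) + ennreal (- F r0)"
      using upper lower \<open>F 0 = 0\<close> by (subst nn_integral_add) auto
    also have "\<dots> = ennreal ((p - q) * pi / 4 - 2 * F r0)"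
      using nonneg by (simp add: ennreal_plus[symmetric] del: ennreal_plus)
    also have "(p - q) * pi / 4 - 2 * F r0 = I"
    proof -
      have "r0 / (1 + r0\<^sup>2) = sqrt (p * q) / (p + q)"
      proof -
        have "p * r0 = sqrt (p * q)"
          using \<open>0 < p\<close> by (simp add: r0_def real_sqrt_mult real_sqrt_divide field_simps)
        moreover have "r0 / (1 + r0\<^sup>2) = p * r0 / (p + q)"
          using \<open>0 < p\<close> q by (simp add: r0 field_simps)
        ultimately show ?thesis by simp
      qed
      \<comment> \<open>\<open>r0\<close> is the reciprocal of \<open>sqrt (p / q)\<close>, and
        arctangents of positive reciprocals add up to \<open>pi / 2\<close>. For
        \<open>q = 0\<close> the convention for \<open>\<theta>\<close> makes the relation hold with
        \<open>r0 = 0\<close>.\<close>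
      moreover have "arctan r0 = pi / 2 - \<theta>"
      proof (cases "q = 0")
        case True
        then show ?thesis using \<open>0 < p\<close> by (simp add: \<theta>_def r0_def)
      next
        case False
        then have "0 < r0" "sqrt (p / q) = 1 / r0"
          using \<open>0 < p\<close> q by (simp_all add: r0_def real_sqrt_divide)
        then show ?thesis
          using False arctan_inverse[of r0] by (simp add: \<theta>_def inverse_eq_divide)
      qed
      ultimately have "F r0 = ((p - q) * (pi / 2 - \<theta>) - sqrt (p * q)) / 2"
        using \<open>0 < p\<close> q by (simp add: F_def)
      then show ?thesis
        by (simp add: I_def algebra_simps diff_divide_distrib add_divide_distrib)
    qed
    finally show ?thesis
      using nonneg \<open>(p - q) * pi / 4 - 2 * F r0 = I\<close> by auto
  qed
  then show "0 \<le> I" "(\<integral>\<^sup>+r. ennreal (\<bar>p * r\<^sup>2 - q\<bar> / (1 + r\<^sup>2)\<^sup>2) * indicator {0..} r \<partial>lborel) = ennreal I"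
    by (simp_all only: g)
qed

lemma nn_integral_even:
  fixes f :: "real \<Rightarrow> ennreal"
  assumes [measurable]: "f \<in> borel_measurable borel" and even: "\<And>r. f (- r) = f r"
  shows "(\<integral>\<^sup>+r. f r \<partial>lborel) = 2 * (\<integral>\<^sup>+r. f r * indicator {0..} r \<partial>lborel)"
proof -
  have "(\<integral>\<^sup>+r. f r \<partial>lborel) = (\<integral>\<^sup>+r. f r * indicator {0..} r + f r * indicator {..0} r \<partial>lborel)"
    using AE_lborel_singleton[of "0::real"]
    by (intro nn_integral_cong_AE) (auto simp: indicator_def)
  also have "\<dots> = (\<integral>\<^sup>+r. f r * indicator {0..} r \<partial>lborel) + (\<integral>\<^sup>+r. f r * indicator {..0} r \<partial>lborel)"
    by (rule nn_integral_add) measurable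
  also have "(\<integral>\<^sup>+r. f r * indicator {..0} r \<partial>lborel) = (\<integral>\<^sup>+r. f r * indicator {0..} r \<partial>lborel)"
    by (subst nn_integral_real_affine[where c = "-1" and t = 0])
      (auto simp: even indicator_def intro!: nn_integral_cong)
  finally show ?thesis
    by (simp add: mult_2)
qed

section \<open>Coordinates of the standard Gaussian vector\<close>

lemma borel_measurable_std_gaussian_density [measurable]:
  "std_gaussian_density \<in> borel_measurable borel"
  unfolding std_gaussian_density_def by measurable

lemma std_gaussian_density_eq_prod:
  fixes z :: "real ^ 'n"
  shows "std_gaussian_density z = (\<Prod>b\<in>Basis. std_normal_density (z \<bullet> b))"
proof -
  have "(\<Prod>b\<in>(Basis :: (real ^ 'n) set). std_normal_density (z \<bullet> b)) =
      (1 / sqrt (2 * pi)) ^ CARD('n) * exp (\<Sum>b\<in>Basis. - (z \<bullet> b)\<^sup>2 / 2)"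
    by (simp add: std_normal_density_def exp_sum prod.distrib prod_dividef power_divide)
  also have "(\<Sum>b\<in>Basis. - (z \<bullet> b)\<^sup>2 / 2) = - (norm z)\<^sup>2 / 2"
  proof -
    have "(norm z)\<^sup>2 = (\<Sum>b\<in>Basis. (z \<bullet> b)\<^sup>2)"
      unfolding power2_norm_eq_inner by (subst euclidean_inner) (simp add: power2_eq_square)
    then show ?thesis
      by (simp add: sum_negf sum_divide_distrib)
  qed
  also have "(1 / sqrt (2 * pi)) ^ CARD('n) = (2 * pi) powr (- (real CARD('n) / 2))"
  proof -
    have "1 / sqrt (2 * pi) = (2 * pi) powr (- (1 / 2))"
      by (simp add: powr_minus powr_half_sqrt inverse_eq_divide)
    then show ?thesis
      by (simp add: powr_power)
  qed
  finally show ?thesis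
    by (simp add: std_gaussian_density_def)
qed

text \<open>The density is a product over coordinates, and each coordinate other than
  \<open>b\<close> and \<open>c\<close> contributes a factor that integrates to 1.\<close>

lemma nn_integral_std_gaussian_marginal:
  fixes G :: "real \<Rightarrow> real \<Rightarrow> ennreal" and b c :: "real ^ 'n"
  assumes [measurable]: "case_prod G \<in> borel_measurable (borel \<Otimes>\<^sub>M borel)"
    and bc: "b \<in> Basis" "c \<in> Basis" "b \<noteq> c"
  shows "(\<integral>\<^sup>+z. ennreal (std_gaussian_density z) * G (z \<bullet> b) (z \<bullet> c) \<partial>lborel) =
    (\<integral>\<^sup>+t. \<integral>\<^sup>+s. ennreal (std_normal_density s * std_normal_density t) * G s t \<partial>lborel \<partial>lborel)"
proof -
  interpret product_sigma_finite "\<lambda>_ :: real ^ 'n. lborel :: real measure"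
    by (simp add: product_sigma_finite_def sigma_finite_lborel)
  define B where "B = Basis - {b, c}"
  have B: "finite B" "b \<notin> B" "c \<notin> insert b B" and Basis: "Basis = insert c (insert b B)"
    using bc by (auto simp: B_def)
  have [simp]: "b \<noteq> c" "c \<noteq> b" "c \<notin> B" "b \<notin> B"
    using bc B by auto
  define H where "H f = (\<Prod>k\<in>Basis. ennreal (std_normal_density (f k))) * G (f b) (f c)" for f
  have [measurable]: "H \<in> borel_measurable (Pi\<^sub>M Basis (\<lambda>_. lborel))"
    unfolding H_def using bc(1,2) by measurable
  have "(\<integral>\<^sup>+z. ennreal (std_gaussian_density z) * G (z \<bullet> b) (z \<bullet> c) \<partial>lborel) =
      (\<integral>\<^sup>+f. H f \<partial>Pi\<^sub>M Basis (\<lambda>_. lborel))"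
  proof -
    \<comment> \<open>\<open>S\<close> rebuilds a vector from its coordinates; it carries the
      product measure to \<open>lborel\<close>.\<close>
    define S where "S f = (\<Sum>k\<in>Basis. f k *\<^sub>R k)" for f :: "real ^ 'n \<Rightarrow> real"
    have S: "S f \<bullet> k = f k" if "k \<in> Basis" for f k
      using that by (simp add: S_def inner_sum_left_Basis)
    have [measurable]: "S \<in> Pi\<^sub>M Basis (\<lambda>_. lborel) \<rightarrow>\<^sub>M borel"
      unfolding S_def by measurable
    have "lborel = distr (Pi\<^sub>M Basis (\<lambda>_. lborel)) borel S"
      unfolding S_def by (rule lborel_eq)
    then have "(\<integral>\<^sup>+z. ennreal (std_gaussian_density z) * G (z \<bullet> b) (z \<bullet> c) \<partial>lborel) =
        (\<integral>\<^sup>+z. ennreal (std_gaussian_density z) * G (z \<bullet> b) (z \<bullet> c) \<partial>distr (Pi\<^sub>M Basis (\<lambda>_. lborel)) borel S)"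
      by (rule arg_cong)
    also have "\<dots> = (\<integral>\<^sup>+f. ennreal (std_gaussian_density (S f)) * G (S f \<bullet> b) (S f \<bullet> c) \<partial>Pi\<^sub>M Basis (\<lambda>_. lborel))"
      by (rule nn_integral_distr) measurable
    also have "\<dots> = (\<integral>\<^sup>+f. H f \<partial>Pi\<^sub>M Basis (\<lambda>_. lborel))"
      using bc(1,2) by (simp add: H_def std_gaussian_density_eq_prod prod_ennreal S)
    finally show ?thesis .
  qed
  \<comment> \<open>Coordinate \<open>c\<close> is split off first and \<open>b\<close> second,
    which leaves the irrelevant coordinates innermost.\<close>
  also have "\<dots> = (\<integral>\<^sup>+t. \<integral>\<^sup>+s. \<integral>\<^sup>+f. H (f(b := s, c := t)) \<partial>Pi\<^sub>M B (\<lambda>_. lborel) \<partial>lborel \<partial>lborel)"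
  proof -
    have "(\<integral>\<^sup>+f. H f \<partial>Pi\<^sub>M Basis (\<lambda>_. lborel)) =
        (\<integral>\<^sup>+t. \<integral>\<^sup>+f. H (f(c := t)) \<partial>Pi\<^sub>M (insert b B) (\<lambda>_. lborel) \<partial>lborel)"
      unfolding Basis using B by (intro product_nn_integral_insert_rev) (simp_all flip: Basis)
    moreover have "(\<integral>\<^sup>+f. H (f(c := t)) \<partial>Pi\<^sub>M (insert b B) (\<lambda>_. lborel)) =
        (\<integral>\<^sup>+s. \<integral>\<^sup>+f. H (f(b := s, c := t)) \<partial>Pi\<^sub>M B (\<lambda>_. lborel) \<partial>lborel)" for t
    proof (rule product_nn_integral_insert_rev)
      have "(\<lambda>f. f(c := t)) \<in> Pi\<^sub>M (insert b B) (\<lambda>_. lborel) \<rightarrow>\<^sub>M Pi\<^sub>M Basis (\<lambda>_. lborel)"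
        by (rule measurable_fun_upd[where J = "insert b B"]) (auto simp: Basis)
      then show "(\<lambda>f. H (f(c := t))) \<in> borel_measurable (Pi\<^sub>M (insert b B) (\<lambda>_. lborel))"
        by (rule measurable_compose) measurable
    qed (use B in auto)
    ultimately show ?thesis by simp
  qed
  also have "\<dots> = (\<integral>\<^sup>+t. \<integral>\<^sup>+s. ennreal (std_normal_density s * std_normal_density t) * G s t \<partial>lborel \<partial>lborel)"
  proof (intro nn_integral_cong)
    fix s t :: real
    have "H (f(b := s, c := t)) = ennreal (std_normal_density s * std_normal_density t) * G s t *
        (\<Prod>k\<in>B. ennreal (std_normal_density (f k)))" for f
    proof -
      have "(\<Prod>k\<in>B. ennreal (std_normal_density ((f(b := s, c := t)) k))) = (\<Prod>k\<in>B. ennreal (std_normal_density (f k)))"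
        by (intro prod.cong) auto
      then show ?thesis
        using B by (simp add: H_def Basis ennreal_mult' mult_ac)
    qed
    moreover have "(\<integral>\<^sup>+f. (\<Prod>k\<in>B. ennreal (std_normal_density (f k))) \<partial>Pi\<^sub>M B (\<lambda>_. lborel)) = 1"
      using B(1) by (subst product_nn_integral_prod) (auto simp: nn_integral_eq_integral)
    ultimately show "(\<integral>\<^sup>+f. H (f(b := s, c := t)) \<partial>Pi\<^sub>M B (\<lambda>_. lborel)) =
        ennreal (std_normal_density s * std_normal_density t) * G s t"
      by (simp add: nn_integral_cmult)
  qed
  finally show ?thesis .
qed

text \<open>A rotation moves \<open>u\<close> and \<open>v\<close> onto two coordinate axes while
  preserving density and Lebesgue measure, so only a two-dimensional integral remains. The factor
  \<open>4 / pi\<close> is \<open>2 / pi\<close> from the substitution, doubled because the kernel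
  is even. Stating the value in \<open>ennreal\<close> avoids a separate integrability
  proof.\<close>

lemma nn_integral_std_gaussian_quadratic_form:
  fixes u v :: "real ^ 'n"
  assumes card: "CARD('n) \<ge> 2" and orth: "u \<bullet> v = 0"
  defines "p \<equiv> u \<bullet> u" and "q \<equiv> v \<bullet> v"
  defines "\<theta> \<equiv> (if q = 0 \<and> 0 < p then pi / 2 else arctan (sqrt (p / q)))"
  defines "J \<equiv> 4 / pi * ((p - q) * \<theta> + sqrt (p * q)) - (p - q)"
  shows "0 \<le> J"
    "(\<integral>\<^sup>+z. ennreal (std_gaussian_density z) * ennreal \<bar>(z \<bullet> u)\<^sup>2 - (z \<bullet> v)\<^sup>2\<bar> \<partial>lborel) = ennreal J"
proof -
  have pq: "0 \<le> p" "0 \<le> q"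
    by (simp_all add: p_def q_def)
  define I where "I = (p - q) * \<theta> + sqrt (p * q) - (p - q) * pi / 4"
  have I: "0 \<le> I"
    "(\<integral>\<^sup>+r. ennreal (\<bar>p * r\<^sup>2 - q\<bar> / (1 + r\<^sup>2)\<^sup>2) * indicator {0..} r \<partial>lborel) = ennreal I"
    using nn_integral_abs_quadratic_kernel[OF pq] by (simp_all add: I_def \<theta>_def)
  have J: "J = 4 / pi * I"
    by (simp add: I_def J_def field_simps)
  then show "0 \<le> J" using I by simp
  obtain i j :: 'n where "i \<noteq> j"
    using card by (metis card_2_iff' ex_card UNIV_I)
  obtain T where T: "orthogonal_transformation T" "T u = axis i (norm u)" "T v = axis j (norm v)"
    using orthogonal_transformation_to_axes[OF orth \<open>i \<noteq> j\<close>] .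
  have [measurable]: "T \<in> borel_measurable borel"
    using T(1) orthogonal_transformation_linear linear_conv_bounded_linear
    by (intro borel_measurable_continuous_onI linear_continuous_on) blast
  have dens: "std_gaussian_density (T z) = std_gaussian_density z" for z
    using T(1) by (simp add: std_gaussian_density_def orthogonal_transformation_norm)
  have quad: "(z \<bullet> u)\<^sup>2 = p * (T z \<bullet> axis i 1)\<^sup>2" "(z \<bullet> v)\<^sup>2 = q * (T z \<bullet> axis j 1)\<^sup>2" for z
  proof -
    have "z \<bullet> u = T z \<bullet> T u" "z \<bullet> v = T z \<bullet> T v"
      using T(1) by (simp_all add: orthogonal_transformation_def)
    then show "(z \<bullet> u)\<^sup>2 = p * (T z \<bullet> axis i 1)\<^sup>2" "(z \<bullet> v)\<^sup>2 = q * (T z \<bullet> axis j 1)\<^sup>2"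
      by (simp_all add: T(2,3) inner_axis p_def q_def power_mult_distrib power2_norm_eq_inner)
  qed
  define G where "G s t = ennreal \<bar>p * s\<^sup>2 - q * t\<^sup>2\<bar>" for s t
  have [measurable]: "case_prod G \<in> borel_measurable (borel \<Otimes>\<^sub>M borel)"
    unfolding G_def by measurable
  \<comment> \<open>\<open>?h\<close> is the integrand in rotated coordinates: the original one is
    \<open>?h\<close> composed with \<open>T\<close>.\<close>
  let ?h = "\<lambda>z :: real ^ 'n. ennreal (std_gaussian_density z) * G (z \<bullet> axis i 1) (z \<bullet> axis j 1)"
  have "(\<integral>\<^sup>+z. ennreal (std_gaussian_density z) * ennreal \<bar>(z \<bullet> u)\<^sup>2 - (z \<bullet> v)\<^sup>2\<bar> \<partial>lborel) =
      (\<integral>\<^sup>+z. ?h (T z) \<partial>lborel)"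
    by (simp add: quad dens G_def)
  also have "\<dots> = (\<integral>\<^sup>+z. ?h z \<partial>distr lborel borel T)"
    by (subst nn_integral_distr) simp_all
  also have "\<dots> = (\<integral>\<^sup>+z. ?h z \<partial>lborel)"
    by (simp only: distr_lborel_orthogonal_transformation[OF T(1)])
  also have "\<dots> = (\<integral>\<^sup>+t. \<integral>\<^sup>+s. ennreal (std_normal_density s * std_normal_density t) * G s t \<partial>lborel \<partial>lborel)"
    using \<open>i \<noteq> j\<close> by (intro nn_integral_std_gaussian_marginal) (auto simp: axis_in_Basis_iff axis_eq_axis)
  also have "\<dots> = (\<integral>\<^sup>+t. \<integral>\<^sup>+s. ennreal (std_normal_density s * std_normal_density t * \<bar>p * s\<^sup>2 - q * t\<^sup>2\<bar>) \<partial>lborel \<partial>lborel)"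
    by (simp add: G_def ennreal_mult)
  also have "\<dots> = (\<integral>\<^sup>+r. ennreal (2 / pi * (\<bar>p * r\<^sup>2 - q\<bar> / (1 + r\<^sup>2)\<^sup>2)) \<partial>lborel)"
    by (rule nn_integral_std_normal_quadratic_form)
  also have "\<dots> = ennreal (2 / pi) * (\<integral>\<^sup>+r. ennreal (\<bar>p * r\<^sup>2 - q\<bar> / (1 + r\<^sup>2)\<^sup>2) \<partial>lborel)"
    by (subst nn_integral_cmult[symmetric]) (simp_all add: ennreal_mult'[symmetric])
  also have "\<dots> = ennreal (2 / pi) * (2 * ennreal I)"
    by (subst nn_integral_even) (simp_all add: I(2))
  also have "\<dots> = ennreal J"
    using I(1) by (simp add: J ennreal_mult'[symmetric] flip: ennreal_numeral)
  finally show "(\<integral>\<^sup>+z. ennreal (std_gaussian_density z) * ennreal \<bar>(z \<bullet> u)\<^sup>2 - (z \<bullet> v)\<^sup>2\<bar> \<partial>lborel) = ennreal J" .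
qed

section \<open>The expectation in terms of the extreme eigenvalues\<close>

theorem corollary5p7:
  fixes M :: "'w measure" and a :: "'w \<Rightarrow> real ^ 'n"
    and xbar x :: "real ^ 'n" and X :: "real ^ 'n ^ 'n"
  assumes "CARD('n) \<ge> 2"
    and "xbar \<noteq> 0"
    and "prob_space M"
    and "std_gaussian M a"
  defines "X \<equiv> outer_square x - outer_square xbar"
  shows "f_P M a xbar x =
    (if X = 0 then 0
     else 4 / pi * (trace X * arctan_ratio X + sqrt \<bar>lambda_max X * lambda_min X\<bar>) - trace X)"
proof -
  \<comment> \<open>The integrand depends on \<open>x\<close> and \<open>xbar\<close> only through
    \<open>X\<close>. It therefore vanishes if \<open>X = 0\<close>, and otherwise \<open>x\<close>,
    \<open>xbar\<close> may be replaced by an orthogonal pair with the same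
    \<open>X\<close>.\<close>
  have quad: "(w \<bullet> x)\<^sup>2 - (w \<bullet> xbar)\<^sup>2 = w \<bullet> (X *v w)" for w
    by (simp add: X_def matrix_vector_mult_diff_rdistrib inner_diff_right inner_outer_square)
  show ?thesis
  proof (cases "X = 0")
    case True
    then show ?thesis
      by (simp add: f_P_def quad)
  next
    case False
    then obtain u v :: "real ^ 'n" where orth: "u \<bullet> v = 0" and X: "X = outer_square u - outer_square v"
      using orthogonal_outer_square_diff[of x xbar] by (auto simp: X_def)
    define p q where "p = u \<bullet> u" and "q = v \<bullet> v"
    have pq: "0 \<le> p" "0 \<le> q"
      by (simp_all add: p_def q_def)
    have eig: "lambda_max X = p" "lambda_min X = - q" and tr: "trace X = p - q"
      using assms(1) orth
      by (simp_all add: X p_def q_def lambda_max_outer_square_diff lambda_min_outer_square_diff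
          trace_sub trace_outer_square)
    define J where "J = 4 / pi * (trace X * arctan_ratio X + sqrt \<bar>lambda_max X * lambda_min X\<bar>) - trace X"
    have J: "0 \<le> J" "(\<integral>\<^sup>+z. ennreal (std_gaussian_density z) * ennreal \<bar>(z \<bullet> u)\<^sup>2 - (z \<bullet> v)\<^sup>2\<bar> \<partial>lborel) = ennreal J"
    proof -
      have "arctan_ratio X = (if q = 0 \<and> 0 < p then pi / 2 else arctan (sqrt (p / q)))"
        using pq by (simp add: arctan_ratio_def eig)
      moreover have "\<bar>lambda_max X * lambda_min X\<bar> = p * q"
        using pq by (simp add: eig abs_mult)
      ultimately have "J = 4 / pi * ((p - q) * (if q = 0 \<and> 0 < p then pi / 2 else arctan (sqrt (p / q))) +
          sqrt (p * q)) - (p - q)"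
        unfolding J_def tr by (simp only:)
      then show "0 \<le> J"
        "(\<integral>\<^sup>+z. ennreal (std_gaussian_density z) * ennreal \<bar>(z \<bullet> u)\<^sup>2 - (z \<bullet> v)\<^sup>2\<bar> \<partial>lborel) = ennreal J"
        using nn_integral_std_gaussian_quadratic_form[OF assms(1) orth, folded p_def q_def]
        by (simp_all only:)
    qed
    have quad': "(w \<bullet> x)\<^sup>2 - (w \<bullet> xbar)\<^sup>2 = (w \<bullet> u)\<^sup>2 - (w \<bullet> v)\<^sup>2" for w
      by (simp add: quad X matrix_vector_mult_diff_rdistrib inner_diff_right inner_outer_square)
    have D: "distributed M lborel a (\<lambda>z. ennreal (std_gaussian_density z))"
      using assms(4) by (simp add: std_gaussian_def)
    have [measurable]: "a \<in> M \<rightarrow>\<^sub>M borel"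
      using distributed_measurable[OF D] by simp
    \<comment> \<open>For a nonnegative measurable integrand the Bochner integral is
      \<open>enn2real\<close> of the nonnegative one; \<open>0 \<le> J\<close> then lets
      \<open>J\<close> be recovered exactly from \<open>ennreal J\<close>.\<close>
    have "f_P M a xbar x = enn2real (\<integral>\<^sup>+w. ennreal \<bar>(a w \<bullet> u)\<^sup>2 - (a w \<bullet> v)\<^sup>2\<bar> \<partial>M)"
      unfolding f_P_def quad' by (rule integral_eq_nn_integral) auto
    also have "(\<integral>\<^sup>+w. ennreal \<bar>(a w \<bullet> u)\<^sup>2 - (a w \<bullet> v)\<^sup>2\<bar> \<partial>M) = ennreal J"
      using distributed_nn_integral[OF D, of "\<lambda>z. ennreal \<bar>(z \<bullet> u)\<^sup>2 - (z \<bullet> v)\<^sup>2\<bar>"] J(2) by simp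
    finally show ?thesis
      using False J(1) by (simp add: J_def)
  qed
qed

end
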